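(* Let $n\ge 3$, let $s_1,\dots,s_n$ be pairwise non-parallel lines through the origin in $\mathbb{R}^2$, and let $t(s_1,\dots,s_n)=k\pi$ (so $1\le k\le n-1$). Then $$\mathbf S_-\cong S^{n-k-2}\times D^{k-1},\qquad \mathbf S_+\cong S^{k-2}\times D^{n-k-1}$$ (homeomorphisms), so $\mathbf S(s_1,\dots,s_n)$ is homeomorphic to $S^{n-k-2}\times D^{k-1}\sqcup S^{k-2}\times D^{n-k-1}$. Here $D^m$ denotes the open $m$-dimensional disc, $D^0$ is a point, and $S^{-1}=\emptyset$.
   Context: For two lines $r,s$ through the origin, $\angle(r,s)$ is the minimal positive angle such that the counterclockwise rotation by $\angle(r,s)$ takes $r$ to $s$, and $t(s_1,\dots,s_n)=\sum_{i=1}^{n-1}\angle(s_i,s_{i+1})+\angle(s_n,s_1)$. For lines $e_1,\dots,e_n$ with $e_i$ parallel to $s_i$, $Q(e_1,\dots,e_n)$ is the closed polygon with consecutive vertices $v_i=e_i\cap e_{i+1}$ (indices mod $n$); $\widetilde{\mathbf S}(s_1,\dots,s_n)$ is the space of such polygons modulo translations. The oriented area of a polygon with vertices $v_i=(x_i,y_i)$ is $\mathcal A=\frac12\sum_i(x_iy_{i+1}-x_{i+1}y_i)$. The configuration space is $\mathbf S(s_1,\dots,s_n)=\{Q\in\widetilde{\mathbf S}:|\mathcal A(Q)|=1\}=\mathbf S_-\sqcup\mathbf S_+$, where $\mathbf S_\pm$ consists of the polygons with $\mathcal A(Q)=\pm1$. *)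

theory Defs
  imports "HOL-Analysis.Analysis"
begin

text \<open>The plane R^2 is modelled by the type complex (x = Re, y = Im).
  Lines through the origin are one-dimensional real subspaces.\<close>

definition line0 :: "complex set \<Rightarrow> bool" where
  "line0 L \<longleftrightarrow> subspace L \<and> dim L = 1"

definition rot :: "real \<Rightarrow> complex \<Rightarrow> complex" where
  "rot \<phi> z = cis \<phi> * z"

definition line_angle :: "complex set \<Rightarrow> complex set \<Rightarrow> real" where
  "line_angle r s = Inf {\<phi>. \<phi> > 0 \<and> rot \<phi> ` r = s}"

definition total_turn :: "nat \<Rightarrow> (nat \<Rightarrow> complex set) \<Rightarrow> real" where
  "total_turn n s = (\<Sum>i<n. line_angle (s i) (s ((i + 1) mod n)))"

text \<open>Closed polygon Q(e_0,...,e_{n-1}) given by its vertex tuple v_i = e_i \<inter> e_{i+1}.\<close>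
definition polygon_of :: "nat \<Rightarrow> (nat \<Rightarrow> complex set) \<Rightarrow> (nat \<Rightarrow> complex)" where
  "polygon_of n e = (\<lambda>i\<in>{..<n}. THE v. v \<in> e i \<inter> e ((i + 1) mod n))"

definition polygons :: "nat \<Rightarrow> (nat \<Rightarrow> complex set) \<Rightarrow> (nat \<Rightarrow> complex) set" where
  "polygons n s = {polygon_of n e | e. \<forall>i<n. \<exists>a. e i = (\<lambda>x. a + x) ` s i}"

definition oriented_area :: "nat \<Rightarrow> (nat \<Rightarrow> complex) \<Rightarrow> real" where
  "oriented_area n v = (1/2) * (\<Sum>i<n. Re (v i) * Im (v ((i + 1) mod n))
                                    - Re (v ((i + 1) mod n)) * Im (v i))"

definition transl_equiv :: "nat \<Rightarrow> (nat \<Rightarrow> complex) \<Rightarrow> (nat \<Rightarrow> complex) \<Rightarrow> bool" where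
  "transl_equiv n v w \<longleftrightarrow> (\<exists>c. \<forall>i<n. w i = v i + c)"

definition quot_class :: "'a topology \<Rightarrow> ('a \<Rightarrow> 'a \<Rightarrow> bool) \<Rightarrow> 'a \<Rightarrow> 'a set" where
  "quot_class X R x = {y \<in> topspace X. R x y}"

definition quotient_top :: "'a topology \<Rightarrow> ('a \<Rightarrow> 'a \<Rightarrow> bool) \<Rightarrow> 'a set topology" where
  "quotient_top X R = topology (\<lambda>U. U \<subseteq> quot_class X R ` topspace X \<and>
        openin X {x \<in> topspace X. quot_class X R x \<in> U})"

lemma istopology_quotient_top:
  "istopology (\<lambda>U. U \<subseteq> quot_class X R ` topspace X \<and>
        openin X {x \<in> topspace X. quot_class X R x \<in> U})"
  unfolding istopology_def
proof (rule conjI; intro allI impI)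
  fix S T :: "'a set set"
  assume a: "S \<subseteq> quot_class X R ` topspace X \<and> openin X {x \<in> topspace X. quot_class X R x \<in> S}"
     and b: "T \<subseteq> quot_class X R ` topspace X \<and> openin X {x \<in> topspace X. quot_class X R x \<in> T}"
  have e: "{x \<in> topspace X. quot_class X R x \<in> S \<inter> T} =
        {x \<in> topspace X. quot_class X R x \<in> S} \<inter> {x \<in> topspace X. quot_class X R x \<in> T}" by blast
  have "openin X {x \<in> topspace X. quot_class X R x \<in> S \<inter> T}"
    unfolding e using a b by (intro openin_Int) simp_all
  moreover have "S \<inter> T \<subseteq> quot_class X R ` topspace X" using a by blast
  ultimately show "S \<inter> T \<subseteq> quot_class X R ` topspace X \<and>
        openin X {x \<in> topspace X. quot_class X R x \<in> S \<inter> T}" by blast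
next
  fix K :: "'a set set set"
  assume a: "\<forall>S\<in>K. S \<subseteq> quot_class X R ` topspace X \<and> openin X {x \<in> topspace X. quot_class X R x \<in> S}"
  have e: "{x \<in> topspace X. quot_class X R x \<in> \<Union>K} = (\<Union>S\<in>K. {x \<in> topspace X. quot_class X R x \<in> S})" by blast
  have "openin X {x \<in> topspace X. quot_class X R x \<in> \<Union>K}"
    unfolding e using a by (intro openin_Union) blast
  moreover have "\<Union>K \<subseteq> quot_class X R ` topspace X" using a by blast
  ultimately show "\<Union>K \<subseteq> quot_class X R ` topspace X \<and> openin X {x \<in> topspace X. quot_class X R x \<in> \<Union>K}"
    by blast
qed

definition polygon_top :: "nat \<Rightarrow> (nat \<Rightarrow> complex set) \<Rightarrow> (nat \<Rightarrow> complex) topology" where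
  "polygon_top n s = subtopology (product_topology (\<lambda>_. euclidean) {..<n}) (polygons n s)"

definition Stilde :: "nat \<Rightarrow> (nat \<Rightarrow> complex set) \<Rightarrow> (nat \<Rightarrow> complex) set topology" where
  "Stilde n s = quotient_top (polygon_top n s) (transl_equiv n)"

text \<open>Classes of polygons with oriented area equal to a (area is translation invariant).\<close>
definition S_area :: "nat \<Rightarrow> (nat \<Rightarrow> complex set) \<Rightarrow> real \<Rightarrow> (nat \<Rightarrow> complex) set topology" where
  "S_area n s a = subtopology (Stilde n s)
      {C \<in> topspace (Stilde n s). \<forall>v\<in>C. oriented_area n v = a}"

definition S_conf :: "nat \<Rightarrow> (nat \<Rightarrow> complex set) \<Rightarrow> (nat \<Rightarrow> complex) set topology" where
  "S_conf n s = subtopology (Stilde n s)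
      {C \<in> topspace (Stilde n s). \<forall>v\<in>C. \<bar>oriented_area n v\<bar> = 1}"

definition sphere_top :: "int \<Rightarrow> (nat \<Rightarrow> real) topology" where
  "sphere_top d = (if d < 0 then trivial_topology else nsphere (nat d))"

definition disc_top :: "nat \<Rightarrow> (nat \<Rightarrow> real) topology" where
  "disc_top m = subtopology (Euclidean_space m) {x. (\<Sum>i<m. x i ^ 2) < 1}"

end

theory Submission
  imports Defs
begin

text \<open>
  Rotate the plane so that the first line is horizontal, and let \<open>\<beta> i\<close> in \<open>(0, pi)\<close> be the angle
  of the \<open>i\<close>-th line. A polygon is determined up to translation by the heights \<open>y i\<close> of its
  vertices above its horizontal edge: that edge has height 0 at both ends, and an edge with height
  difference \<open>h\<close> and slope angle \<open>b\<close> has horizontal extent \<open>h * cot b\<close>. So the polygons modulo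
  translation form \<open>R^(n-2)\<close>, and in these coordinates the area is already diagonal: summation by
  parts in the shoelace formula gives half the sum of \<open>(cot (\<beta> (i+1)) - cot (\<beta> i)) * (y i)^2\<close>.
  A coefficient is positive exactly at a descent \<open>\<beta> (i+1) < \<beta> i\<close>, and the total turn is
  \<open>pi\<close> times (1 + number of descents), so the form has \<open>k - 1\<close> positive and \<open>n - k - 1\<close> negative
  squares. Its level sets are products of a sphere and an open disc.
\<close>

section \<open>Quotients, disjoint sums and quadrics\<close>

lemma openin_quotient_top:
  "openin (quotient_top X R) U \<longleftrightarrow>
     U \<subseteq> quot_class X R ` topspace X \<and> openin X {x \<in> topspace X. quot_class X R x \<in> U}"
  unfolding quotient_top_def using istopology_quotient_top[of X R] by simp

lemma topspace_quotient_top: "topspace (quotient_top X R) = quot_class X R ` topspace X"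
proof
  have "{x \<in> topspace X. quot_class X R x \<in> quot_class X R ` topspace X} = topspace X"
    by auto
  then have "openin (quotient_top X R) (quot_class X R ` topspace X)"
    unfolding openin_quotient_top by simp
  then show "quot_class X R ` topspace X \<subseteq> topspace (quotient_top X R)"
    by (rule openin_subset)
  show "topspace (quotient_top X R) \<subseteq> quot_class X R ` topspace X"
    using openin_quotient_top openin_topspace by blast
qed

text \<open>A continuous map with a continuous section is a quotient map, and \<open>R\<close> is by
  assumption the relation of having the same image under it. The second conclusion records that
  every class is a nonempty set on which \<open>f\<close> is constant; it later turns conditions on
  all representatives into conditions on \<open>F C\<close>.\<close>

lemma homeomorphic_maps_quotient_top:
  assumes f: "continuous_map X Y f" and g: "continuous_map Y X g"
    and fg: "\<And>y. y \<in> topspace Y \<Longrightarrow> f (g y) = y"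
    and R: "\<And>x x'. x \<in> topspace X \<Longrightarrow> x' \<in> topspace X \<Longrightarrow> R x x' \<longleftrightarrow> f x = f x'"
  obtains F where "homeomorphic_maps (quotient_top X R) Y F (\<lambda>y. quot_class X R (g y))"
    and "\<forall>C \<in> topspace (quotient_top X R). C \<noteq> {} \<and> C \<subseteq> topspace X \<and> (\<forall>x\<in>C. f x = F C)"
proof -
  let ?q = "quot_class X R"
  \<comment> \<open>The choice is harmless: \<open>f\<close> agrees on all members of a
    class.\<close>
  define F where "F C = f (SOME x. x \<in> C)" for C
  have q: "?q x = {x' \<in> topspace X. f x = f x'}" if "x \<in> topspace X" for x
    unfolding quot_class_def using R that by auto
  have F: "F (?q x) = f x" if "x \<in> topspace X" for x
  proof -
    have "x \<in> ?q x" using q that by auto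
    then have "(SOME y. y \<in> ?q x) \<in> ?q x" by (rule someI)
    then show ?thesis using q[OF that] unfolding F_def by auto
  qed
  have gX: "g y \<in> topspace X" if "y \<in> topspace Y" for y
    using g that by (auto simp: continuous_map_def)
  have contF: "continuous_map (quotient_top X R) Y F"
    unfolding continuous_map_def
  proof (intro conjI allI impI)
    show "F \<in> topspace (quotient_top X R) \<rightarrow> topspace Y"
      using f F by (auto simp: topspace_quotient_top continuous_map_def)
    fix U assume U: "openin Y U"
    have "{x \<in> topspace X. ?q x \<in> {C \<in> topspace (quotient_top X R). F C \<in> U}}
        = {x \<in> topspace X. f x \<in> U}"
      using F by (auto simp: topspace_quotient_top)
    then show "openin (quotient_top X R) {C \<in> topspace (quotient_top X R). F C \<in> U}"
      unfolding openin_quotient_top[of X R "{C \<in> topspace (quotient_top X R). F C \<in> U}"]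
      using f U by (auto simp: topspace_quotient_top continuous_map_def)
  qed
  have contq: "continuous_map X (quotient_top X R) ?q"
    unfolding continuous_map_def by (auto simp: topspace_quotient_top openin_quotient_top)
  have "homeomorphic_maps (quotient_top X R) Y F (\<lambda>y. ?q (g y))"
    unfolding homeomorphic_maps_def
  proof (intro conjI ballI)
    show "continuous_map Y (quotient_top X R) (\<lambda>y. ?q (g y))"
      using continuous_map_compose[OF g contq] by (simp add: o_def)
    fix C assume "C \<in> topspace (quotient_top X R)"
    then obtain x where x: "x \<in> topspace X" "C = ?q x" by (auto simp: topspace_quotient_top)
    have "f x \<in> topspace Y" using f x by (auto simp: continuous_map_def)
    then show "?q (g (F C)) = C"
      using x F q fg gX by auto
  qed (use contF F fg gX in auto)
  moreover have "\<forall>C \<in> topspace (quotient_top X R). C \<noteq> {} \<and> C \<subseteq> topspace X \<and> (\<forall>x\<in>C. f x = F C)"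
    unfolding topspace_quotient_top
  proof
    fix C assume "C \<in> ?q ` topspace X"
    then obtain x where x: "x \<in> topspace X" "C = ?q x" by blast
    then show "C \<noteq> {} \<and> C \<subseteq> topspace X \<and> (\<forall>x\<in>C. f x = F C)"
      using F[OF x(1)] q[OF x(1)] by auto
  qed
  ultimately show thesis by (rule that)
qed

text \<open>The homeomorphisms \<open>Y i\<close> to \<open>U i\<close> glue to one bijection
  \<open>G\<close>. It is continuous because openness in a sum is tested summand by summand, and
  open because each \<open>U i\<close> is open in \<open>X\<close>.\<close>

lemma homeomorphic_space_sum_topology:
  assumes op: "\<And>i. i \<in> I \<Longrightarrow> openin X (U i)"
    and cover: "topspace X = (\<Union>i\<in>I. U i)"
    and disj: "\<And>i j. i \<in> I \<Longrightarrow> j \<in> I \<Longrightarrow> i \<noteq> j \<Longrightarrow> U i \<inter> U j = {}"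
    and hom: "\<And>i. i \<in> I \<Longrightarrow> subtopology X (U i) homeomorphic_space Y i"
  shows "X homeomorphic_space sum_topology Y I"
proof -
  have "\<exists>g. homeomorphic_map (Y i) (subtopology X (U i)) g" if "i \<in> I" for i
    using hom[OF that] by (metis homeomorphic_space homeomorphic_space_sym)
  then obtain g where g: "\<And>i. i \<in> I \<Longrightarrow> homeomorphic_map (Y i) (subtopology X (U i)) (g i)"
    by metis
  have UX: "U i \<subseteq> topspace X" if "i \<in> I" for i using op[OF that] openin_subset by blast
  have im: "g i ` topspace (Y i) = U i" if "i \<in> I" for i
    using homeomorphic_imp_surjective_map[OF g[OF that]] UX[OF that] by auto
  have inj: "inj_on (g i) (topspace (Y i))" if "i \<in> I" for i
    using homeomorphic_imp_injective_map[OF g[OF that]] .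
  define G where "G = (\<lambda>(i, y). g i y)"
  have "homeomorphic_map (sum_topology Y I) X G"
  proof (rule bijective_open_imp_homeomorphic_map)
    show "continuous_map (sum_topology Y I) X G"
      unfolding continuous_map_def
    proof (intro conjI allI impI)
      show "G \<in> topspace (sum_topology Y I) \<rightarrow> topspace X"
      proof
        fix p assume "p \<in> topspace (sum_topology Y I)"
        then obtain i y where "p = (i, y)" "i \<in> I" "y \<in> topspace (Y i)" by auto
        then show "G p \<in> topspace X" using im[of i] UX[of i] by (auto simp: G_def)
      qed
      fix V assume V: "openin X V"
      have "openin (Y i) {y \<in> topspace (Y i). g i y \<in> V}" if "i \<in> I" for i
      proof -
        have "continuous_map (Y i) X (g i)"
          using homeomorphic_imp_continuous_map[OF g[OF that]]
          by (rule continuous_map_into_fulltopology)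
        then show ?thesis using V by (rule openin_continuous_map_preimage)
      qed
      moreover have "{y. (i, y) \<in> {p \<in> topspace (sum_topology Y I). G p \<in> V}}
          = {y \<in> topspace (Y i). g i y \<in> V}" if "i \<in> I" for i
        using that by (auto simp: G_def)
      ultimately show "openin (sum_topology Y I) {p \<in> topspace (sum_topology Y I). G p \<in> V}"
        by (simp add: openin_sum_topology)
    qed
    show "open_map (sum_topology Y I) X G"
      unfolding open_map_def
    proof (intro allI impI)
      fix W assume W: "openin (sum_topology Y I) W"
      have eq: "G ` W = (\<Union>i\<in>I. g i ` {y. (i, y) \<in> W})"
      proof (intro subset_antisym subsetI)
        fix x assume "x \<in> G ` W"
        then obtain i y where iy: "(i, y) \<in> W" "x = g i y" by (auto simp: G_def)
        moreover have "i \<in> I" using openin_subset[OF W] iy(1) by auto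
        ultimately show "x \<in> (\<Union>i\<in>I. g i ` {y. (i, y) \<in> W})" by blast
      next
        fix x assume "x \<in> (\<Union>i\<in>I. g i ` {y. (i, y) \<in> W})"
        then obtain i y where "(i, y) \<in> W" "x = G (i, y)" by (auto simp: G_def)
        then show "x \<in> G ` W" by blast
      qed
      have "openin X (g i ` {y. (i, y) \<in> W})" if "i \<in> I" for i
      proof -
        have "openin (Y i) {y. (i, y) \<in> W}"
          using W that by (simp add: openin_sum_topology)
        then have "openin (subtopology X (U i)) (g i ` {y. (i, y) \<in> W})"
          using homeomorphic_imp_open_map[OF g[OF that]] unfolding open_map_def by blast
        then show ?thesis using op[OF that] by (rule openin_trans_full)
      qed
      then show "openin X (G ` W)" unfolding eq by blast
    qed
    show "G ` topspace (sum_topology Y I) = topspace X"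
    proof -
      have "G ` topspace (sum_topology Y I) = (\<Union>i\<in>I. g i ` topspace (Y i))"
        unfolding G_def topspace_sum_topology Sigma_def image_UN by auto
      then show ?thesis using im cover by simp
    qed
    show "inj_on G (topspace (sum_topology Y I))"
    proof (rule inj_onI)
      fix p q assume p: "p \<in> topspace (sum_topology Y I)" and q: "q \<in> topspace (sum_topology Y I)"
        and e: "G p = G q"
      obtain i y where iy: "p = (i, y)" "i \<in> I" "y \<in> topspace (Y i)" using p by auto
      obtain j z where jz: "q = (j, z)" "j \<in> I" "z \<in> topspace (Y j)" using q by auto
      have "g i y \<in> U i" "g j z \<in> U j" using iy jz im by auto
      then have "i = j" using disj[of i j] iy jz e by (auto simp: G_def)
      then show "p = q" using iy jz e inj[of i] by (auto simp: G_def inj_on_def)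
    qed
  qed
  then show ?thesis
    by (metis homeomorphic_map_imp_homeomorphic_space homeomorphic_space_sym)
qed

section \<open>Level sets of diagonal quadratic forms\<close>

text \<open>The unit sphere of a \<open>p\<close>-dimensional space has dimension
  \<open>p - 1\<close>. For \<open>p = 0\<close> the equation reads \<open>0 = 1\<close>, which
  matches the convention that the sphere of dimension -1 is empty.\<close>

lemma sphere_top_conv_Euclidean:
  "sphere_top (int p - 1) = subtopology (Euclidean_space p) {x. (\<Sum>i<p. x i ^ 2) = 1}"
proof (cases p)
  case 0
  then show ?thesis by (simp add: sphere_top_def)
next
  case (Suc m)
  then show ?thesis by (simp add: sphere_top_def nsphere_def lessThan_Suc_atMost)
qed

text \<open>Rescaling coordinates by \<open>sqrt\<close> of the absolute value of their coefficients
  leaves only the signature of the form. Without positive coefficients both sides are empty.\<close>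

lemma quadric_homeomorphic_sphere_times_disc:
  fixes a :: "'i \<Rightarrow> real"
  assumes fin: "finite I" and nz: "\<And>i. i \<in> I \<Longrightarrow> a i \<noteq> 0"
  shows "subtopology (product_topology (\<lambda>_. euclideanreal) I) {x. (\<Sum>i\<in>I. a i * x i ^ 2) = 1}
    homeomorphic_space
      prod_topology (sphere_top (int (card {i\<in>I. a i > 0}) - 1)) (disc_top (card {i\<in>I. a i < 0}))"
    (is "?X homeomorphic_space prod_topology (sphere_top (int ?p - 1)) (disc_top ?q)")
proof -
  define X where "X = subtopology (product_topology (\<lambda>_. euclideanreal) I) {x. (\<Sum>i\<in>I. a i * x i ^ 2) = 1}"
  define W where "W = prod_topology (sphere_top (int ?p - 1)) (disc_top ?q)"
  let ?P = "{i\<in>I. a i > 0}" and ?N = "{i\<in>I. a i < 0}"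
  \<comment> \<open>Sphere and disc use coordinates numbered from 0, whereas the form is indexed by
    \<open>I\<close>; \<open>f\<close> and \<open>g\<close> enumerate the positive and the negative
    indices.\<close>
  obtain f where f: "bij_betw f {..<?p} ?P"
    using ex_bij_betw_nat_finite[of ?P] fin by (auto simp: atLeast0LessThan)
  obtain g where g: "bij_betw g {..<?q} ?N"
    using ex_bij_betw_nat_finite[of ?N] fin by (auto simp: atLeast0LessThan)
  define f' where "f' = inv_into {..<?p} f"
  define g' where "g' = inv_into {..<?q} g"
  have fk: "f k \<in> I" "a (f k) > 0" "f' (f k) = k" if "k < ?p" for k
    using f that unfolding f'_def by (auto simp: bij_betw_inv_into_left bij_betw_def)
  have gk: "g k \<in> I" "a (g k) < 0" "g' (g k) = k" if "k < ?q" for k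
    using g that unfolding g'_def by (auto simp: bij_betw_inv_into_left bij_betw_def)
  have f': "f' j < ?p" "f (f' j) = j" if "j \<in> I" "a j > 0" for j
    using f that bij_betw_inv_into_right[OF f] bij_betw_inv_into[OF f] unfolding f'_def bij_betw_def
    by auto
  have g': "g' j < ?q" "g (g' j) = j" if "j \<in> I" "a j < 0" for j
    using g that bij_betw_inv_into_right[OF g] bij_betw_inv_into[OF g] unfolding g'_def bij_betw_def
    by auto
  have split: "(\<Sum>i\<in>I. h i) = (\<Sum>k<?p. h (f k)) + (\<Sum>k<?q. h (g k))" for h :: "'i \<Rightarrow> real"
  proof -
    have "I = ?P \<union> ?N" using nz by force
    then have "(\<Sum>i\<in>I. h i) = sum h (?P \<union> ?N)" by (rule arg_cong)
    also have "\<dots> = sum h ?P + sum h ?N"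
      by (rule sum.union_disjoint) (use fin in auto)
    finally have "(\<Sum>i\<in>I. h i) = sum h ?P + sum h ?N" .
    then show ?thesis
      using sum.reindex_bij_betw[OF f, of h] sum.reindex_bij_betw[OF g, of h] by simp
  qed
  define r where "r x = sqrt (\<Sum>k<?p. a (f k) * x (f k) ^ 2)" for x :: "'i \<Rightarrow> real"
  define d where "d w = sqrt (1 - (\<Sum>k<?q. snd w k ^ 2))" for w :: "(nat \<Rightarrow> real) \<times> (nat \<Rightarrow> real)"
  \<comment> \<open>Writing a point of the quadric as \<open>(u, w)\<close> with \<open>|u|^2 = 1 + |w|^2\<close>, the homeomorphism divides
    both components by \<open>|u|\<close>; its inverse divides by \<open>sqrt (1 - |w|^2)\<close>.\<close>
  define F where "F x = (\<lambda>k. if k < ?p then sqrt (a (f k)) * x (f k) / r x else 0,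
                         \<lambda>k. if k < ?q then sqrt (- a (g k)) * x (g k) / r x else 0)" for x
  define G where "G w = (\<lambda>j\<in>I. if a j > 0 then fst w (f' j) / (sqrt (a j) * d w)
                              else snd w (g' j) / (sqrt (- a j) * d w))" for w
  have topX: "topspace X = {x \<in> extensional I. (\<Sum>i\<in>I. a i * x i ^ 2) = 1}"
    by (auto simp: X_def PiE_def)
  have topW: "topspace W = {w. (\<forall>k\<ge>?p. fst w k = 0) \<and> (\<Sum>k<?p. fst w k ^ 2) = 1 \<and>
      (\<forall>k\<ge>?q. snd w k = 0) \<and> (\<Sum>k<?q. snd w k ^ 2) < 1}"
    by (auto simp: W_def sphere_top_conv_Euclidean disc_top_def topspace_Euclidean_space)
  have r2: "(\<Sum>k<?p. a (f k) * x (f k) ^ 2) = 1 + (\<Sum>k<?q. - a (g k) * x (g k) ^ 2)"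
    if "x \<in> topspace X" for x
    using that unfolding topX split by (simp add: sum_negf)
  have rpos: "r x > 0" "r x ^ 2 = (\<Sum>k<?p. a (f k) * x (f k) ^ 2)" if "x \<in> topspace X" for x
  proof -
    have "(\<Sum>k<?q. - a (g k) * x (g k) ^ 2) \<ge> 0"
      by (intro sum_nonneg mult_nonneg_nonneg) (use gk in \<open>auto intro: less_imp_le\<close>)
    then show "r x > 0" "r x ^ 2 = (\<Sum>k<?p. a (f k) * x (f k) ^ 2)"
      using r2[OF that] unfolding r_def by auto
  qed
  \<comment> \<open>Here \<open>r x\<close> is \<open>|u|\<close>, so the equation of the quadric is
    \<open>|w|^2 = r x ^ 2 - 1\<close>. The exact value in \<open>F2\<close> gives both the bound by
    1 and the scale factor needed to invert \<open>F\<close>.\<close>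
  have F1: "(\<Sum>k<?p. fst (F x) k ^ 2) = 1" and F2: "(\<Sum>k<?q. snd (F x) k ^ 2) = 1 - 1 / r x ^ 2"
    if x: "x \<in> topspace X" for x
  proof -
    have "(\<Sum>k<?p. fst (F x) k ^ 2) = (\<Sum>k<?p. a (f k) * x (f k) ^ 2 / r x ^ 2)"
      by (rule sum.cong) (use fk in \<open>auto simp: F_def power_mult_distrib power_divide less_imp_le\<close>)
    also have "\<dots> = r x ^ 2 / r x ^ 2"
      unfolding rpos(2)[OF x] by (rule sum_divide_distrib[symmetric])
    also have "\<dots> = 1"
      using rpos(1)[OF x] by simp
    finally show "(\<Sum>k<?p. fst (F x) k ^ 2) = 1" .
    have "(\<Sum>k<?q. snd (F x) k ^ 2) = (\<Sum>k<?q. - a (g k) * x (g k) ^ 2 / r x ^ 2)"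
      by (rule sum.cong) (use gk in \<open>auto simp: F_def power_mult_distrib power_divide less_imp_le\<close>)
    also have "\<dots> = (r x ^ 2 - 1) / r x ^ 2"
      using r2[OF x] unfolding rpos(2)[OF x] sum_divide_distrib[symmetric] by simp
    finally show "(\<Sum>k<?q. snd (F x) k ^ 2) = 1 - 1 / r x ^ 2"
      using rpos(1)[OF x] by (simp add: field_simps)
  qed
  have dF: "d (F x) = 1 / r x" if "x \<in> topspace X" for x
    using F2[OF that] rpos(1)[OF that] by (simp add: d_def real_sqrt_divide)
  have dpos: "d w > 0" "d w ^ 2 = 1 - (\<Sum>k<?q. snd w k ^ 2)" if "w \<in> topspace W" for w
    using that unfolding topW d_def by auto
  have G1: "(\<Sum>k<?p. a (f k) * G w (f k) ^ 2) = 1 / d w ^ 2"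
    and G2: "(\<Sum>k<?q. a (g k) * G w (g k) ^ 2) = 1 - 1 / d w ^ 2"
    if w: "w \<in> topspace W" for w
  proof -
    have "(\<Sum>k<?p. a (f k) * G w (f k) ^ 2) = (\<Sum>k<?p. fst w k ^ 2 / d w ^ 2)"
    proof (rule sum.cong)
      fix k assume "k \<in> {..<?p}"
      then have "k < ?p" by simp
      then show "a (f k) * G w (f k) ^ 2 = fst w k ^ 2 / d w ^ 2"
        using fk[of k] dpos(1)[OF w] by (simp add: G_def power_mult_distrib power_divide)
    qed simp
    then show "(\<Sum>k<?p. a (f k) * G w (f k) ^ 2) = 1 / d w ^ 2"
      using w unfolding topW by (simp flip: sum_divide_distrib)
    have "(\<Sum>k<?q. a (g k) * G w (g k) ^ 2) = (\<Sum>k<?q. - (snd w k ^ 2 / d w ^ 2))"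
    proof (rule sum.cong)
      fix k assume "k \<in> {..<?q}"
      then have "k < ?q" by simp
      then show "a (g k) * G w (g k) ^ 2 = - (snd w k ^ 2 / d w ^ 2)"
        using gk[of k] dpos(1)[OF w] by (simp add: G_def power_mult_distrib power_divide)
    qed simp
    then have "(\<Sum>k<?q. a (g k) * G w (g k) ^ 2) = - ((\<Sum>k<?q. snd w k ^ 2) / d w ^ 2)"
      by (simp add: sum_negf flip: sum_divide_distrib)
    also have "(\<Sum>k<?q. snd w k ^ 2) = 1 - d w ^ 2"
      using dpos(2)[OF w] by simp
    finally show "(\<Sum>k<?q. a (g k) * G w (g k) ^ 2) = 1 - 1 / d w ^ 2"
      using dpos(1)[OF w] by (simp add: field_simps)
  qed
  have FX: "F x \<in> topspace W" if "x \<in> topspace X" for x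
    using F1[OF that] F2[OF that] rpos(1)[OF that] unfolding topW by (auto simp: F_def)
  have GW: "G w \<in> topspace X" if "w \<in> topspace W" for w
    using G1[OF that] G2[OF that] unfolding topX split by (auto simp: G_def)
  have rG: "r (G w) = 1 / d w" if "w \<in> topspace W" for w
    using G1[OF that] dpos(1)[OF that] by (simp add: r_def real_sqrt_divide)
  \<comment> \<open>The scale factors are reciprocal: \<open>d (F x) = 1 / r x\<close> and, for the
    other composition, \<open>r (G w) = 1 / d w\<close>. Each is rewritten before the inner map is
    unfolded, hence the paired simplifier calls.\<close>
  have GF: "G (F x) = x" if x: "x \<in> topspace X" for x
  proof
    fix j
    consider "j \<notin> I" | "j \<in> I" "a j > 0" | "j \<in> I" "a j < 0" using nz by force
    then show "G (F x) j = x j"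
    proof cases
      case 1 then show ?thesis using x unfolding topX by (auto simp: G_def extensional_def)
    next
      case 2 then show ?thesis using f'[of j] rpos(1)[OF x]
        by (simp add: G_def dF[OF x]) (simp add: F_def)
    next
      case 3 then show ?thesis using g'[of j] rpos(1)[OF x]
        by (simp add: G_def dF[OF x]) (simp add: F_def)
    qed
  qed
  have FG: "F (G w) = w" if w: "w \<in> topspace W" for w
  proof (rule prod_eqI; rule ext)
    fix k
    show "fst (F (G w)) k = fst w k"
    proof (cases "k < ?p")
      case True then show ?thesis using fk[of k] dpos(1)[OF w]
        by (simp add: F_def rG[OF w]) (simp add: G_def)
    next
      case False then show ?thesis using w unfolding topW by (simp add: F_def)
    qed
    show "snd (F (G w)) k = snd w k"
    proof (cases "k < ?q")
      case True then show ?thesis using gk[of k] dpos(1)[OF w]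
        by (simp add: F_def rG[OF w]) (simp add: G_def)
    next
      case False then show ?thesis using w unfolding topW by (simp add: F_def)
    qed
  qed
  have projX: "continuous_map X euclideanreal (\<lambda>x. x i)" if "i \<in> I" for i
    unfolding X_def using that by (intro continuous_map_from_subtopology continuous_map_product_projection)
  have cr: "continuous_map X euclideanreal r"
    unfolding r_def[abs_def] using fk by (intro continuous_intros projX) auto
  have contE1: "continuous_map X (Euclidean_space ?p) (\<lambda>x. fst (F x))"
    unfolding F_def fst_conv continuous_map_componentwise_Euclidean_space
    by (intro allI impI continuous_intros projX cr fk(1)) (use rpos(1) in force)+
  have contE2: "continuous_map X (Euclidean_space ?q) (\<lambda>x. snd (F x))"
    unfolding F_def snd_conv continuous_map_componentwise_Euclidean_space
    by (intro allI impI continuous_intros projX cr gk(1)) (use rpos(1) in force)+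
  have "continuous_map X (sphere_top (int ?p - 1)) (\<lambda>x. fst (F x))"
    unfolding sphere_top_conv_Euclidean
    by (rule continuous_map_into_subtopology[OF contE1]) (use F1 in auto)
  moreover have "continuous_map X (disc_top ?q) (\<lambda>x. snd (F x))"
    unfolding disc_top_def
    by (rule continuous_map_into_subtopology[OF contE2]) (use FX topW in auto)
  ultimately have contF: "continuous_map X W F"
    unfolding W_def continuous_map_pairwise o_def by simp
  have cfst: "continuous_map W euclideanreal (\<lambda>w. fst w k)" for k
  proof -
    have "continuous_map (sphere_top (int ?p - 1)) euclideanreal (\<lambda>y. y k)"
      unfolding sphere_top_conv_Euclidean Euclidean_space_def
      by (intro continuous_map_from_subtopology continuous_map_product_projection) simp
    from continuous_map_compose[OF continuous_map_fst this] show ?thesis unfolding W_def by (simp add: o_def)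
  qed
  have csnd: "continuous_map W euclideanreal (\<lambda>w. snd w k)" for k
  proof -
    have "continuous_map (disc_top ?q) euclideanreal (\<lambda>y. y k)"
      unfolding disc_top_def Euclidean_space_def
      by (intro continuous_map_from_subtopology continuous_map_product_projection) simp
    from continuous_map_compose[OF continuous_map_snd this] show ?thesis unfolding W_def by (simp add: o_def)
  qed
  have cd: "continuous_map W euclideanreal d"
    unfolding d_def[abs_def] by (intro continuous_intros csnd) auto
  have "continuous_map W (product_topology (\<lambda>_. euclideanreal) I) G"
    unfolding continuous_map_componentwise
  proof (intro conjI ballI)
    show "G ` topspace W \<subseteq> extensional I" by (auto simp: G_def)
    fix j assume j: "j \<in> I"
    have dn: "d w \<noteq> 0" if "w \<in> topspace W" for w using dpos(1)[OF that] by simp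
    show "continuous_map W euclideanreal (\<lambda>w. G w j)"
    proof (cases "a j > 0")
      case True
      have "continuous_map W euclideanreal (\<lambda>w. fst w (f' j) / (sqrt (a j) * d w))"
        using True dn by (intro continuous_intros cfst cd) auto
      then show ?thesis using True j by (simp add: G_def)
    next
      case False
      have "continuous_map W euclideanreal (\<lambda>w. snd w (g' j) / (sqrt (- a j) * d w))"
        using False dn nz[OF j] by (intro continuous_intros csnd cd) auto
      then show ?thesis using False j by (simp add: G_def)
    qed
  qed
  then have contG: "continuous_map W X G"
    using GW topX unfolding X_def by (auto simp: continuous_map_in_subtopology)
  show ?thesis
    unfolding homeomorphic_space_def homeomorphic_maps_def X_def[symmetric] W_def[symmetric]
    using contF contG GF FG by blast
qed

section \<open>Lines through the origin and their angles\<close>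

text \<open>The line through the origin with direction angle \<open>\<theta>\<close>, given by an
  equation: rotating back by \<open>\<theta>\<close> must land on the real axis.\<close>

definition line_at :: "real \<Rightarrow> complex set" where
  "line_at \<theta> = {z. Im (z * cis (-\<theta>)) = 0}"

lemma mem_line_at: "z \<in> line_at \<theta> \<longleftrightarrow> Im z * cos \<theta> = Re z * sin \<theta>"
  by (auto simp: line_at_def)

lemma cis_mem_line_at_iff: "cis \<theta>' \<in> line_at \<theta> \<longleftrightarrow> sin (\<theta>' - \<theta>) = 0"
  by (auto simp: mem_line_at sin_diff)

text \<open>The vanishing sine makes \<open>cis (\<theta>' - \<theta>)\<close> a nonzero real
  number, so the two defining equations are proportional.\<close>

lemma line_at_cong:
  assumes "sin (\<theta>' - \<theta>) = 0"
  shows "line_at \<theta>' = line_at \<theta>"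
proof -
  have c: "cos (\<theta>' - \<theta>) \<noteq> 0" using assms sin_cos_squared_add[of "\<theta>' - \<theta>"] by auto
  have "Im (z * cis (-\<theta>)) = cos (\<theta>' - \<theta>) * Im (z * cis (-\<theta>'))" for z
  proof -
    have "cis (-\<theta>) = cis (-\<theta>') * cis (\<theta>' - \<theta>)" by (simp add: cis_mult)
    also have "cis (\<theta>' - \<theta>) = of_real (cos (\<theta>' - \<theta>))"
      using assms by (simp add: complex_eq_iff)
    finally show ?thesis by (simp add: algebra_simps)
  qed
  then show ?thesis using c by (auto simp: line_at_def)
qed

lemma line_at_eq_iff: "line_at \<theta>' = line_at \<theta> \<longleftrightarrow> sin (\<theta>' - \<theta>) = 0"
  using line_at_cong cis_mem_line_at_iff[of \<theta>' \<theta>] cis_mem_line_at_iff[of \<theta>' \<theta>'] by auto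

lemma line_at_add_pi [simp]: "line_at (\<theta> + pi) = line_at \<theta>"
  by (rule line_at_cong) simp

lemma rot_image_line_at: "rot \<phi> ` line_at \<theta> = line_at (\<theta> + \<phi>)"
proof
  have "rot \<phi> z * cis (- (\<theta> + \<phi>)) = z * cis (-\<theta>)" for z
    by (simp add: rot_def cis_mult mult.commute[of "cis \<phi>"] mult.assoc)
  then show "rot \<phi> ` line_at \<theta> \<subseteq> line_at (\<theta> + \<phi>)"
    unfolding line_at_def by (simp only: image_subset_iff mem_Collect_eq) blast
  show "line_at (\<theta> + \<phi>) \<subseteq> rot \<phi> ` line_at \<theta>"
  proof
    fix z assume z: "z \<in> line_at (\<theta> + \<phi>)"
    have "z = rot \<phi> (z * cis (-\<phi>))"
      by (simp add: rot_def mult.left_commute[of "cis \<phi>"] cis_mult)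
    moreover have "z * cis (-\<phi>) * cis (-\<theta>) = z * cis (- (\<theta> + \<phi>))"
      by (simp add: mult.assoc cis_mult add.commute)
    ultimately show "z \<in> rot \<phi> ` line_at \<theta>"
      using z unfolding line_at_def by (metis (mono_tags, lifting) image_eqI mem_Collect_eq)
  qed
qed

lemma line0_imp_line_at:
  assumes "line0 L"
  obtains \<theta> where "L = line_at \<theta>"
proof -
  obtain B where B: "B \<subseteq> L" "independent B" "span B = L" "card B = 1"
    using assms basis_subspace_exists[of L] unfolding line0_def by metis
  then obtain b where b: "B = {b}" by (auto simp: card_1_singleton_iff)
  then have b0: "b \<noteq> 0" using B dependent_zero by blast
  define \<theta> where "\<theta> = Arg b"
  have bc: "b = of_real (cmod b) * cis \<theta>"
    unfolding \<theta>_def using rcis_cmod_Arg[of b] by (simp add: rcis_def)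
  have "L = line_at \<theta>"
  proof (intro subset_antisym subsetI)
    fix z assume "z \<in> L"
    then obtain k where "z = k *\<^sub>R b" using B b by (auto simp: span_singleton)
    then have "z = of_real (k * cmod b) * cis \<theta>"
      by (subst (asm) bc) (simp add: scaleR_conv_of_real)
    then show "z \<in> line_at \<theta>" by (simp add: mem_line_at)
  next
    fix z assume "z \<in> line_at \<theta>"
    then have "z * cis (-\<theta>) = of_real (Re (z * cis (-\<theta>)))"
      by (simp add: line_at_def complex_eq_iff)
    then have "z * cis (-\<theta>) * cis \<theta> = of_real (Re (z * cis (-\<theta>))) * cis \<theta>"
      by simp
    then have "z = of_real (Re (z * cis (-\<theta>))) * cis \<theta>"
      by (simp add: mult.assoc cis_mult)
    also have "\<dots> = (Re (z * cis (-\<theta>)) / cmod b) *\<^sub>R b"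
      by (subst (2) bc) (use b0 in \<open>simp add: scaleR_conv_of_real\<close>)
    finally show "z \<in> L" using B b by (auto simp: span_singleton)
  qed
  then show thesis using that by blast
qed

text \<open>Direction angles matter only modulo \<open>pi\<close>, so subtracting a multiple of
  \<open>pi\<close> found by the floor function brings the difference into the half-open interval
  from 0 to \<open>pi\<close>. The value 0 would give the excluded line.\<close>

lemma line0_relative_angle:
  assumes "line0 L" "L \<noteq> line_at \<theta>"
  obtains \<beta> where "0 < \<beta>" "\<beta> < pi" "L = line_at (\<theta> + \<beta>)"
proof -
  obtain \<theta>' where \<theta>': "L = line_at \<theta>'" using line0_imp_line_at[OF assms(1)] .
  define m where "m = \<lfloor>(\<theta>' - \<theta>) / pi\<rfloor>"
  define \<beta> where "\<beta> = \<theta>' - \<theta> - of_int m * pi"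
  have "of_int m \<le> (\<theta>' - \<theta>) / pi" "(\<theta>' - \<theta>) / pi < of_int m + 1"
    unfolding m_def by linarith+
  then have b: "0 \<le> \<beta>" "\<beta> < pi"
    unfolding \<beta>_def by (simp_all add: field_simps)
  have "sin (\<theta>' - (\<theta> + \<beta>)) = 0"
    unfolding \<beta>_def by (simp add: sin_zero_iff_int2)
  then have L: "L = line_at (\<theta> + \<beta>)" using \<theta>' line_at_cong by blast
  moreover have "\<beta> \<noteq> 0" using L assms(2) by auto
  ultimately show thesis using b that[of \<beta>] by simp
qed

text \<open>The infimum is attained: a smaller positive rotation would leave a remaining angle
  strictly between 0 and \<open>pi\<close>, where the sine is positive, and so would not reach the
  target line.\<close>

lemma line_angle_line_at:
  assumes "0 < \<theta>' - \<theta>" "\<theta>' - \<theta> \<le> pi"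
  shows "line_angle (line_at \<theta>) (line_at \<theta>') = \<theta>' - \<theta>"
  unfolding line_angle_def
proof (rule cInf_eq_minimum)
  show "\<theta>' - \<theta> \<in> {\<phi>. \<phi> > 0 \<and> rot \<phi> ` line_at \<theta> = line_at \<theta>'}"
    using assms by (simp add: rot_image_line_at)
  fix \<phi> assume "\<phi> \<in> {\<phi>. \<phi> > 0 \<and> rot \<phi> ` line_at \<theta> = line_at \<theta>'}"
  then have p: "\<phi> > 0" "sin (\<theta>' - (\<theta> + \<phi>)) = 0"
    by (auto simp: rot_image_line_at line_at_eq_iff sin_diff[of \<theta>'] sin_diff[of "\<theta> + \<phi>"] mult.commute)
  show "\<theta>' - \<theta> \<le> \<phi>"
  proof (rule ccontr)
    assume "\<not> ?thesis"
    then have "sin (\<theta>' - (\<theta> + \<phi>)) > 0" using p assms by (intro sin_gt_zero) auto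
    then show False using p by simp
  qed
qed

text \<open>Cramer's rule for two linear equations in \<open>Re v\<close> and \<open>Im v\<close>,
  whose determinant is \<open>sin (\<theta>' - \<theta>)\<close> up to sign.\<close>

lemma ex1_translated_lines_inter:
  assumes "sin (\<theta>' - \<theta>) \<noteq> 0"
  shows "\<exists>!v. v \<in> (\<lambda>x. a + x) ` line_at \<theta> \<inter> (\<lambda>x. b + x) ` line_at \<theta>'"
proof -
  define D where "D = sin (\<theta>' - \<theta>)"
  have D: "D = sin \<theta>' * cos \<theta> - cos \<theta>' * sin \<theta>" "D \<noteq> 0"
    using assms by (auto simp: D_def sin_diff)
  have mem: "v \<in> (\<lambda>x. c + x) ` line_at \<phi> \<longleftrightarrow> v - c \<in> line_at \<phi>" for v c \<phi>
    by (auto simp: image_iff algebra_simps intro: bexI[of _ "v - c"])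
  define A where "A = Im a * cos \<theta> - Re a * sin \<theta>"
  define B where "B = Im b * cos \<theta>' - Re b * sin \<theta>'"
  have iff: "v \<in> (\<lambda>x. a + x) ` line_at \<theta> \<inter> (\<lambda>x. b + x) ` line_at \<theta>' \<longleftrightarrow>
      Im v * cos \<theta> - Re v * sin \<theta> = A \<and> Im v * cos \<theta>' - Re v * sin \<theta>' = B" for v
    unfolding Int_iff mem mem_line_at A_def B_def by (auto simp: algebra_simps)
  have "Im v * cos \<theta> - Re v * sin \<theta> = A \<and> Im v * cos \<theta>' - Re v * sin \<theta>' = B \<longleftrightarrow>
      v = Complex ((A * cos \<theta>' - B * cos \<theta>) / D) ((A * sin \<theta>' - B * sin \<theta>) / D)" for v
  proof
    assume h: "Im v * cos \<theta> - Re v * sin \<theta> = A \<and> Im v * cos \<theta>' - Re v * sin \<theta>' = B"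
    have "A * cos \<theta>' - B * cos \<theta> = Re v * D" "A * sin \<theta>' - B * sin \<theta> = Im v * D"
      unfolding D(1) conjunct1[OF h, symmetric] conjunct2[OF h, symmetric]
      by (simp_all add: algebra_simps)
    then show "v = Complex ((A * cos \<theta>' - B * cos \<theta>) / D) ((A * sin \<theta>' - B * sin \<theta>) / D)"
      using D(2) by (simp add: complex_eq_iff)
  next
    assume h: "v = Complex ((A * cos \<theta>' - B * cos \<theta>) / D) ((A * sin \<theta>' - B * sin \<theta>) / D)"
    have "(A * sin \<theta>' - B * sin \<theta>) * cos \<theta> - (A * cos \<theta>' - B * cos \<theta>) * sin \<theta> = A * D"
      "(A * sin \<theta>' - B * sin \<theta>) * cos \<theta>' - (A * cos \<theta>' - B * cos \<theta>) * sin \<theta>' = B * D"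
      unfolding D(1) by (simp_all add: algebra_simps)
    then show "Im v * cos \<theta> - Re v * sin \<theta> = A \<and> Im v * cos \<theta>' - Re v * sin \<theta>' = B"
      using D(2) unfolding h by (simp add: field_simps)
  qed
  then show ?thesis unfolding iff by simp
qed

section \<open>Cyclic sums, total turn and cotangents\<close>

lemma sum_cyclic_shift:
  fixes h :: "nat \<Rightarrow> 'a::comm_monoid_add"
  assumes "n > 0"
  shows "(\<Sum>i<n. h ((i + 1) mod n)) = (\<Sum>i<n. h i)"
proof -
  obtain m where n: "n = Suc m" using assms gr0_conv_Suc by blast
  have "(\<Sum>i<m. h ((i + 1) mod n)) = (\<Sum>i<m. h (Suc i))"
    by (rule sum.cong) (auto simp: n)
  then have "(\<Sum>i<n. h ((i + 1) mod n)) = (\<Sum>i<m. h (Suc i)) + h 0"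
    by (simp add: n)
  also have "\<dots> = (\<Sum>i<n. h i)"
    unfolding n by (subst sum.lessThan_Suc_shift) (simp add: add.commute)
  finally show ?thesis .
qed

text \<open>Summation by parts, with \<open>c i\<close> the horizontal run per unit of height along
  edge \<open>i\<close>. Adding one edge replaces the boundary term at \<open>m\<close> by the one
  at \<open>Suc m\<close> and leaves a pure square of \<open>y m\<close>. The boundary term
  disappears once the final height is 0.\<close>

lemma shoelace_partial_sum:
  fixes x y c :: "nat \<Rightarrow> real"
  assumes "y 0 = 0" and "m \<ge> 1"
    and "\<And>i. i < m \<Longrightarrow> x (Suc i) - x i = c (Suc i) * (y (Suc i) - y i)"
  shows "(\<Sum>i<m. x i * y (Suc i) - x (Suc i) * y i) =
      x m * y m - c m * y m ^ 2 + (\<Sum>i=1..<m. (c (Suc i) - c i) * y i ^ 2)"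
  using assms(2,3)
proof (induction m rule: dec_induct)
  case base
  then have "x 1 = x 0 + c 1 * y 1" using assms(1) by (auto simp: algebra_simps)
  then show ?case using assms(1) by (simp add: algebra_simps power2_eq_square)
next
  case (step m)
  have x: "x (Suc m) = x m + c (Suc m) * (y (Suc m) - y m)"
    using step.prems[of m] by simp
  have "(\<Sum>i<m. x i * y (Suc i) - x (Suc i) * y i) =
      x m * y m - c m * y m ^ 2 + (\<Sum>i=1..<m. (c (Suc i) - c i) * y i ^ 2)"
    using step by simp
  then show ?case using step.hyps
    by (simp add: x sum.atLeastLessThan_Suc) (simp add: algebra_simps power2_eq_square)
qed

text \<open>Each middle turn is a difference of consecutive \<open>\<beta>\<close>, plus
  \<open>pi\<close> at a descent. The differences telescope and cancel against the first turn
  \<open>\<beta> 1\<close> and the closing turn \<open>pi - \<beta> (n - 1)\<close>, leaving one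
  \<open>pi\<close> and one more per descent.\<close>

lemma total_turn_line_at:
  assumes n: "n \<ge> 3" and s0: "s 0 = line_at \<theta>"
    and s: "\<And>i. 0 < i \<Longrightarrow> i < n \<Longrightarrow> s i = line_at (\<theta> + \<beta> i)"
    and \<beta>: "\<And>i. 0 < i \<Longrightarrow> i < n \<Longrightarrow> 0 < \<beta> i \<and> \<beta> i < pi"
    and ne: "\<And>i. 0 < i \<Longrightarrow> Suc i < n \<Longrightarrow> \<beta> i \<noteq> \<beta> (Suc i)"
  shows "total_turn n s = (1 + real (card {i \<in> {1..<n-1}. \<beta> (Suc i) < \<beta> i})) * pi"
proof -
  let ?D = "{i \<in> {1..<n-1}. \<beta> (Suc i) < \<beta> i}"
  let ?t = "\<lambda>i. line_angle (s i) (s ((i + 1) mod n))"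
  have first: "?t 0 = \<beta> 1"
    using n \<beta>[of 1] line_angle_line_at[of "\<theta> + \<beta> 1" \<theta>] by (simp add: s0 s)
  \<comment> \<open>The closing turn ends at \<open>s 0\<close>, represented here by
    \<open>\<theta> + pi\<close> so that the angle increases; the descents below use the same shift
    by \<open>pi\<close>.\<close>
  have last: "?t (n - 1) = pi - \<beta> (n - 1)"
    using n \<beta>[of "n - 1"] line_angle_line_at[of "\<theta> + pi" "\<theta> + \<beta> (n - 1)"] by (simp add: s0 s)
  have mid: "?t i = (\<beta> (Suc i) - \<beta> i) + (if \<beta> (Suc i) < \<beta> i then pi else 0)" if "i \<in> {1..<n-1}" for i
  proof -
    have i: "0 < i" "Suc i < n" using that by auto
    have e: "?t i = line_angle (line_at (\<theta> + \<beta> i)) (line_at (\<theta> + \<beta> (Suc i)))"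
      using i by (simp add: s)
    show ?thesis
    proof (cases "\<beta> (Suc i) < \<beta> i")
      case True
      have "line_angle (line_at (\<theta> + \<beta> i)) (line_at (\<theta> + \<beta> (Suc i) + pi)) = \<theta> + \<beta> (Suc i) + pi - (\<theta> + \<beta> i)"
        by (rule line_angle_line_at) (use True i \<beta>[of i] \<beta>[of "Suc i"] in auto)
      then show ?thesis using e True by simp
    next
      case False
      have "line_angle (line_at (\<theta> + \<beta> i)) (line_at (\<theta> + \<beta> (Suc i))) = \<theta> + \<beta> (Suc i) - (\<theta> + \<beta> i)"
        by (rule line_angle_line_at) (use False i ne[of i] \<beta>[of i] \<beta>[of "Suc i"] in auto)
      then show ?thesis using e False by simp
    qed
  qed
  have "{..<n} = insert 0 (insert (n - 1) {1..<n-1})" using n by auto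
  then have split: "sum t {..<n} = t 0 + (t (n - 1) + sum t {1..<n-1})" for t :: "nat \<Rightarrow> real"
    using n by simp
  have "total_turn n s = ?t 0 + (?t (n - 1) + (\<Sum>i\<in>{1..<n-1}. ?t i))"
    unfolding total_turn_def by (rule split)
  also have "(\<Sum>i\<in>{1..<n-1}. ?t i) =
      (\<Sum>i=1..<n-1. \<beta> (Suc i) - \<beta> i) + (\<Sum>i=1..<n-1. if \<beta> (Suc i) < \<beta> i then pi else 0)"
    unfolding sum.distrib[symmetric] by (rule sum.cong[OF refl mid])
  also have "(\<Sum>i=1..<n-1. \<beta> (Suc i) - \<beta> i) = \<beta> (n - 1) - \<beta> 1"
    by (rule sum_Suc_diff') (use n in simp)
  also have "(\<Sum>i=1..<n-1. if \<beta> (Suc i) < \<beta> i then pi else 0) = real (card ?D) * pi"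
    by (simp add: sum.If_cases Int_def)
  finally show ?thesis unfolding first last by (simp add: algebra_simps)
qed

text \<open>In the frame where the line at \<open>\<theta>\<close> is horizontal, horizontal extent
  is \<open>cot \<beta>\<close> times height. Using the cotangent includes vertical lines and
  excludes only horizontal ones.\<close>

lemma mem_line_at_add_iff:
  assumes "sin \<beta> \<noteq> 0"
  shows "z \<in> line_at (\<theta> + \<beta>) \<longleftrightarrow> Re (z * cis (-\<theta>)) = cot \<beta> * Im (z * cis (-\<theta>))"
proof -
  have "z * cis (- (\<theta> + \<beta>)) = z * cis (-\<theta>) * cis (-\<beta>)"
    by (simp add: mult.assoc cis_mult)
  then have "z \<in> line_at (\<theta> + \<beta>) \<longleftrightarrow> z * cis (-\<theta>) \<in> line_at \<beta>"
    unfolding line_at_def mem_Collect_eq by (simp only:)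
  then show ?thesis using assms
    unfolding mem_line_at by (auto simp: cot_def field_simps simp del: times_complex.sel)
qed

lemma cot_diff:
  fixes a b :: real
  assumes "sin a \<noteq> 0" "sin b \<noteq> 0"
  shows "cot a - cot b = sin (b - a) / (sin a * sin b)"
  using assms by (simp add: cot_def sin_diff field_simps)

lemma cot_strict_antimono:
  fixes a b :: real
  assumes "0 < a" "a < b" "b < pi"
  shows "cot b < cot a"
proof -
  have "sin a > 0" "sin b > 0" "sin (b - a) > 0" using assms by (auto intro: sin_gt_zero)
  then have "cot a - cot b > 0" using cot_diff[of a b] by simp
  then show ?thesis by simp
qed

section \<open>Polygons in height coordinates\<close>

locale line_config =
  fixes n :: nat and s :: "nat \<Rightarrow> complex set" and \<theta> :: real and \<beta> :: "nat \<Rightarrow> real"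
  assumes n3: "n \<ge> 3" and s_0: "s 0 = line_at \<theta>"
    and s_pos: "\<And>i. 0 < i \<Longrightarrow> i < n \<Longrightarrow> s i = line_at (\<theta> + \<beta> i)"
    and beta_range: "\<And>i. 0 < i \<Longrightarrow> i < n \<Longrightarrow> 0 < \<beta> i \<and> \<beta> i < pi"
    and beta_neq: "\<And>i. 0 < i \<Longrightarrow> Suc i < n \<Longrightarrow> \<beta> i \<noteq> \<beta> (Suc i)"
begin

lemma sin_beta: "0 < i \<Longrightarrow> i < n \<Longrightarrow> sin (\<beta> i) \<noteq> 0"
  using beta_range[of i] sin_gt_zero[of "\<beta> i"] by auto

lemma consecutive_inter:
  assumes "i < n"
  shows "\<exists>!v. v \<in> (\<lambda>x. a + x) ` s i \<inter> (\<lambda>x. b + x) ` s ((i + 1) mod n)"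
proof -
  consider "i = 0" | "0 < i" "Suc i < n" | "i = n - 1" "0 < i"
    using assms n3 by linarith
  then show ?thesis
  proof cases
    case 1
    then show ?thesis using n3 ex1_translated_lines_inter[of "\<theta> + \<beta> 1" \<theta> a b] sin_beta[of 1]
      by (simp add: s_0 s_pos)
  next
    case 2
    have "sin (\<beta> (Suc i) - \<beta> i) \<noteq> 0"
    proof (cases "\<beta> i < \<beta> (Suc i)")
      case True
      then have "sin (\<beta> (Suc i) - \<beta> i) > 0"
        using beta_range[of i] beta_range[of "Suc i"] 2 by (intro sin_gt_zero) auto
      then show ?thesis by simp
    next
      case False
      then have "sin (\<beta> i - \<beta> (Suc i)) > 0"
        using beta_range[of i] beta_range[of "Suc i"] beta_neq[of i] 2 by (intro sin_gt_zero) auto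
      then show ?thesis by (metis less_irrefl minus_diff_eq neg_equal_0_iff_equal sin_minus)
    qed
    then show ?thesis
      using 2 ex1_translated_lines_inter[of "\<theta> + \<beta> (Suc i)" "\<theta> + \<beta> i" a b] by (simp add: s_pos)
  next
    case 3
    then show ?thesis using n3 ex1_translated_lines_inter[of \<theta> "\<theta> + \<beta> i" a b] sin_beta[of i] assms
      by (simp add: s_0 s_pos)
  qed
qed

lemma subspace_s: "i < n \<Longrightarrow> subspace (s i)"
proof -
  have "subspace (line_at \<phi>)" for \<phi>
    by (auto simp: subspace_def mem_line_at algebra_simps)
  then show "i < n \<Longrightarrow> subspace (s i)" using s_0 s_pos by (cases "i = 0") auto
qed

text \<open>Trades the lines for edge vectors: \<open>v i\<close> and its successor both lie on the
  line with the successor's index, hence the shifted index of \<open>s\<close>. Conversely the lines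
  are recovered as the translates of \<open>s i\<close> through \<open>v i\<close>. Edges of length
  zero are allowed.\<close>

lemma polygons_iff:
  "v \<in> polygons n s \<longleftrightarrow>
     v \<in> extensional {..<n} \<and> (\<forall>i<n. v ((i + 1) mod n) - v i \<in> s ((i + 1) mod n))"
proof
  assume "v \<in> polygons n s"
  then obtain e where e: "v = polygon_of n e" "\<forall>i<n. \<exists>a. e i = (\<lambda>x. a + x) ` s i"
    unfolding polygons_def by blast
  have vi: "v i \<in> e i \<inter> e ((i + 1) mod n)" if i: "i < n" for i
  proof -
    obtain a where a: "e i = (\<lambda>x. a + x) ` s i" using e(2) i by auto
    have "(i + 1) mod n < n" using i by simp
    then obtain b where b: "e ((i + 1) mod n) = (\<lambda>x. b + x) ` s ((i + 1) mod n)"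
      using e(2) by auto
    have "\<exists>!w. w \<in> e i \<inter> e ((i + 1) mod n)"
      unfolding a b by (rule consecutive_inter[OF i])
    then have "(THE w. w \<in> e i \<inter> e ((i + 1) mod n)) \<in> e i \<inter> e ((i + 1) mod n)"
      by (rule theI')
    then show ?thesis using e(1) i by (simp add: polygon_of_def)
  qed
  have "v ((i + 1) mod n) - v i \<in> s ((i + 1) mod n)" if i: "i < n" for i
  proof -
    let ?j = "(i + 1) mod n"
    have j: "?j < n" using i by simp
    obtain b where b: "e ?j = (\<lambda>x. b + x) ` s ?j" using e(2) j by auto
    have "v i \<in> e ?j" "v ?j \<in> e ?j" using vi[OF i] vi[OF j] by auto
    then obtain x y where "v i = b + x" "v ?j = b + y" "x \<in> s ?j" "y \<in> s ?j" unfolding b by auto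
    then show ?thesis using subspace_diff[OF subspace_s[OF j], of y x] by simp
  qed
  then show "v \<in> extensional {..<n} \<and> (\<forall>i<n. v ((i + 1) mod n) - v i \<in> s ((i + 1) mod n))"
    using e(1) by (auto simp: polygon_of_def)
next
  assume v: "v \<in> extensional {..<n} \<and> (\<forall>i<n. v ((i + 1) mod n) - v i \<in> s ((i + 1) mod n))"
  define e where "e i = (\<lambda>x. v i + x) ` s i" for i
  have "v = polygon_of n e"
  proof
    fix i
    show "v i = polygon_of n e i"
    proof (cases "i < n")
      case True
      let ?j = "(i + 1) mod n"
      have j: "?j < n" using True by simp
      have "v i \<in> e i" unfolding e_def using subspace_0[OF subspace_s[OF True]]
        by (rule rev_image_eqI) simp
      moreover have "v i \<in> e ?j"
      proof -
        have "- (v ?j - v i) \<in> s ?j"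
          using v True subspace_neg[OF subspace_s[OF j]] by blast
        then show ?thesis unfolding e_def by (rule rev_image_eqI) simp
      qed
      ultimately have "(THE w. w \<in> e i \<inter> e ?j) = v i"
        using consecutive_inter[OF True, of "v i" "v ?j"] unfolding e_def
        by (intro the1_equality) auto
      then show ?thesis using True by (simp add: polygon_of_def)
    next
      case False
      then show ?thesis using v by (auto simp: polygon_of_def extensional_def)
    qed
  qed
  then show "v \<in> polygons n s" unfolding polygons_def e_def by blast
qed

section \<open>Reconstruction of a polygon from its heights\<close>

definition heights :: "(nat \<Rightarrow> complex) \<Rightarrow> nat \<Rightarrow> real" where
  "heights v = (\<lambda>i\<in>{1..<n-1}. Im ((v i - v 0) * cis (-\<theta>)))"

text \<open>Both end points of the edge on the first line, \<open>v (n-1)\<close> and \<open>v 0\<close>, have height 0.\<close>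

definition pad :: "(nat \<Rightarrow> real) \<Rightarrow> nat \<Rightarrow> real" where
  "pad y i = (if i \<in> {1..<n-1} then y i else 0)"

text \<open>The horizontal coordinate of vertex \<open>i\<close> relative to vertex 0, accumulated
  along the edges: the edge from vertex \<open>j\<close> to vertex \<open>Suc j\<close> lies on line
  \<open>Suc j\<close>.\<close>

definition offset :: "(nat \<Rightarrow> real) \<Rightarrow> nat \<Rightarrow> real" where
  "offset y i = (\<Sum>j<i. cot (\<beta> (Suc j)) * (pad y (Suc j) - pad y j))"

definition of_heights :: "(nat \<Rightarrow> real) \<Rightarrow> nat \<Rightarrow> complex" where
  "of_heights y = (\<lambda>i\<in>{..<n}. (of_real (offset y i) + \<i> * of_real (pad y i)) * cis \<theta>)"

text \<open>The coefficient of a squared height in the area; the division by 2 is that of the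
  shoelace formula.\<close>

definition weight :: "nat \<Rightarrow> real" where
  "weight i = (cot (\<beta> (Suc i)) - cot (\<beta> i)) / 2"

lemma of_heights_rotated:
  "i < n \<Longrightarrow> of_heights y i * cis (-\<theta>) = of_real (offset y i) + \<i> * of_real (pad y i)"
  by (simp add: of_heights_def mult.assoc cis_mult)

lemma of_heights_0: "of_heights y 0 = 0"
  using n3 by (simp add: of_heights_def offset_def pad_def)

text \<open>The definition of \<open>offset\<close> gives every edge but the closing one its
  direction. The closing edge joins two vertices of height 0 and so lies along \<open>s 0\<close>
  automatically: the heights can be prescribed freely.\<close>

lemma of_heights_in_polygons: "of_heights y \<in> polygons n s"
  unfolding polygons_iff
proof (intro conjI allI impI)
  show "of_heights y \<in> extensional {..<n}" by (simp add: of_heights_def)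
  fix i assume i: "i < n"
  show "of_heights y ((i + 1) mod n) - of_heights y i \<in> s ((i + 1) mod n)"
  proof (cases "Suc i < n")
    case True
    have "(of_heights y (Suc i) - of_heights y i) * cis (-\<theta>) =
        of_real (offset y (Suc i) - offset y i) + \<i> * of_real (pad y (Suc i) - pad y i)"
      unfolding left_diff_distrib of_heights_rotated[OF i] of_heights_rotated[OF True]
      by (simp add: algebra_simps)
    then have "of_heights y (Suc i) - of_heights y i \<in> line_at (\<theta> + \<beta> (Suc i))"
      unfolding mem_line_at_add_iff[OF sin_beta[OF zero_less_Suc True]]
      by (simp add: offset_def)
    then show ?thesis using True by (simp add: s_pos)
  next
    case False
    then have i: "i = n - 1" using i by simp
    have "Im (of_heights y (n - 1) * cis (-\<theta>)) = 0"
      using of_heights_rotated[of "n - 1" y] n3 by (simp add: pad_def)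
    then have "- of_heights y (n - 1) \<in> s 0"
      using subspace_neg[OF subspace_s[of 0]] n3 by (simp add: s_0 line_at_def)
    then show ?thesis using n3 by (simp add: i of_heights_0)
  qed
qed

lemma heights_of_heights:
  assumes "y \<in> extensional {1..<n-1}"
  shows "heights (of_heights y) = y"
proof
  fix i
  show "heights (of_heights y) i = y i"
  proof (cases "i \<in> {1..<n-1}")
    case True
    then have "i < n" by auto
    then show ?thesis using True of_heights_rotated[of i y]
      by (simp add: heights_def of_heights_0 pad_def del: times_complex.sel)
  next
    case False
    then show ?thesis using assms by (auto simp: heights_def extensional_def)
  qed
qed

lemma polygon_edge:
  assumes v: "v \<in> polygons n s" and i: "Suc i < n"
  shows "Re ((v (Suc i) - v 0) * cis (-\<theta>)) - Re ((v i - v 0) * cis (-\<theta>)) =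
    cot (\<beta> (Suc i)) * (Im ((v (Suc i) - v 0) * cis (-\<theta>)) - Im ((v i - v 0) * cis (-\<theta>)))"
proof -
  have "v (Suc i) - v i \<in> s (Suc i)"
    using v i unfolding polygons_iff by (metis Suc_eq_plus1 Suc_lessD mod_less)
  then have "Re ((v (Suc i) - v i) * cis (-\<theta>)) = cot (\<beta> (Suc i)) * Im ((v (Suc i) - v i) * cis (-\<theta>))"
    using mem_line_at_add_iff[OF sin_beta[OF zero_less_Suc i]] i by (simp only: s_pos zero_less_Suc)
  moreover have "(v (Suc i) - v i) * cis (-\<theta>) = (v (Suc i) - v 0) * cis (-\<theta>) - (v i - v 0) * cis (-\<theta>)"
    by (simp add: algebra_simps)
  ultimately show ?thesis by (simp only: minus_complex.sel)
qed

lemma pad_heights: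
  assumes v: "v \<in> polygons n s" and i: "i < n"
  shows "pad (heights v) i = Im ((v i - v 0) * cis (-\<theta>))"
proof -
  consider "i = 0" | "i \<in> {1..<n-1}" | "i = n - 1" using i by force
  then show ?thesis
  proof cases
    case 1 then show ?thesis by (simp add: pad_def)
  next
    case 2 then show ?thesis by (simp add: pad_def heights_def)
  next
    \<comment> \<open>The closing edge has the direction of \<open>s 0\<close>, so the last vertex
      has height 0, the default value in \<open>pad\<close>.\<close>
    case 3
    have "(n - 1 + 1) mod n = 0" using n3 by simp
    then have "v 0 - v (n - 1) \<in> s 0"
      using v n3 unfolding polygons_iff by (metis diff_less less_numeral_extra(1) order_less_le_trans zero_less_numeral)
    then have "v (n - 1) - v 0 \<in> s 0"
      using subspace_neg[OF subspace_s[of 0]] n3 by fastforce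
    then show ?thesis unfolding s_0 line_at_def 3 by (simp add: pad_def)
  qed
qed

lemma offset_heights:
  assumes v: "v \<in> polygons n s" and "i < n"
  shows "offset (heights v) i = Re ((v i - v 0) * cis (-\<theta>))"
  using assms(2)
proof (induction i)
  case 0
  then show ?case by (simp add: offset_def)
next
  case (Suc i)
  have "offset (heights v) (Suc i) = offset (heights v) i +
      cot (\<beta> (Suc i)) * (pad (heights v) (Suc i) - pad (heights v) i)"
    by (simp add: offset_def)
  then show ?case
    using Suc polygon_edge[OF v Suc.prems] pad_heights[OF v Suc.prems] pad_heights[OF v, of i]
    by (simp del: times_complex.sel)
qed

lemma of_heights_heights:
  assumes v: "v \<in> polygons n s" and i: "i < n"
  shows "of_heights (heights v) i = v i - v 0"
proof -
  have "of_heights (heights v) i * cis (-\<theta>) = (v i - v 0) * cis (-\<theta>)"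
    unfolding of_heights_rotated[OF i] offset_heights[OF v i] pad_heights[OF v i]
    by (rule complex_eq[symmetric])
  then show ?thesis by simp
qed

text \<open>Heights only see differences to \<open>v 0\<close>, and by reconstruction they determine
  all these differences; the translation is then \<open>w 0 - v 0\<close>.\<close>

lemma transl_equiv_iff_heights:
  assumes "v \<in> polygons n s" "w \<in> polygons n s"
  shows "transl_equiv n v w \<longleftrightarrow> heights v = heights w"
proof
  assume "transl_equiv n v w"
  then obtain c where "\<forall>i<n. w i = v i + c" unfolding transl_equiv_def by blast
  then show "heights v = heights w" using n3 by (auto simp: heights_def fun_eq_iff)
next
  assume e: "heights v = heights w"
  have "w i = v i + (w 0 - v 0)" if "i < n" for i
    using of_heights_heights[OF assms(1) that] of_heights_heights[OF assms(2) that] e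
    by (simp add: algebra_simps)
  then show "transl_equiv n v w" unfolding transl_equiv_def by blast
qed

lemma oriented_area_heights:
  assumes v: "v \<in> polygons n s"
  shows "oriented_area n v = (\<Sum>i\<in>{1..<n-1}. weight i * heights v i ^ 2)"
proof -
  define x where "x i = Re ((v i - v 0) * cis (-\<theta>))" for i
  define y where "y i = Im ((v i - v 0) * cis (-\<theta>))" for i
  define W where "W i = v i - v 0" for i
  have y_last: "y (n-1) = 0"
    using pad_heights[OF v, of "n-1"] n3 by (simp add: y_def pad_def)
  \<comment> \<open>The cross product is \<open>Im (cnj a * b)\<close>, in which a common factor of
    modulus 1 cancels.\<close>
  have rotate: "Re (W i) * Im (W j) - Re (W j) * Im (W i) = x i * y j - x j * y i" for i j
  proof -
    have "Re a * Im b - Re b * Im a = Im (cnj a * b)" for a b :: complex by simp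
    moreover have "cnj (W i * cis (-\<theta>)) * (W j * cis (-\<theta>)) = cnj (W i) * W j"
      by (simp add: cis_cnj cis_mult mult.assoc mult.left_commute[of "cis \<theta>"])
    ultimately show ?thesis unfolding x_def y_def W_def by metis
  qed
  \<comment> \<open>The correction for moving the origin to \<open>v 0\<close> is linear in the
    increments of \<open>W\<close>, so it sums to zero around the closed polygon.\<close>
  have cross: "Re (v i) * Im (v j) - Re (v j) * Im (v i) =
      (x i * y j - x j * y i) + (Re (v 0) * (Im (W j) - Im (W i)) - Im (v 0) * (Re (W j) - Re (W i)))" for i j
    unfolding rotate[symmetric] W_def by (simp add: algebra_simps)
  have "2 * oriented_area n v =
      (\<Sum>i<n. Re (v i) * Im (v ((i + 1) mod n)) - Re (v ((i + 1) mod n)) * Im (v i))"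
    unfolding oriented_area_def by simp
  also have "\<dots> = (\<Sum>i<n. x i * y ((i + 1) mod n) - x ((i + 1) mod n) * y i)
      + (Re (v 0) * (\<Sum>i<n. Im (W ((i + 1) mod n)) - Im (W i))
         - Im (v 0) * (\<Sum>i<n. Re (W ((i + 1) mod n)) - Re (W i)))"
    by (simp only: cross sum.distrib sum_subtractf sum_distrib_left right_diff_distrib)
  also have "\<dots> = (\<Sum>i<n. x i * y ((i + 1) mod n) - x ((i + 1) mod n) * y i)"
    using sum_cyclic_shift[of n "\<lambda>i. Im (W i)"] sum_cyclic_shift[of n "\<lambda>i. Re (W i)"] n3
    by (simp add: sum_subtractf)
  \<comment> \<open>The wrap-around term vanishes because both vertices of the closing edge have
    height 0.\<close>
  also have "\<dots> = (\<Sum>i<n-1. x i * y (Suc i) - x (Suc i) * y i)"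
  proof -
    obtain m where m: "n = Suc m" using n3 by (cases n) auto
    have "y 0 = 0" by (simp add: y_def)
    moreover have "y m = 0" using y_last by (simp add: m)
    moreover have "(\<Sum>i<m. x i * y ((i + 1) mod n) - x ((i + 1) mod n) * y i) =
        (\<Sum>i<m. x i * y (Suc i) - x (Suc i) * y i)"
      by (rule sum.cong) (auto simp: m)
    ultimately show ?thesis by (simp add: m)
  qed
  also have "\<dots> = x (n-1) * y (n-1) - cot (\<beta> (n-1)) * y (n-1) ^ 2
      + (\<Sum>i=1..<n-1. (cot (\<beta> (Suc i)) - cot (\<beta> i)) * y i ^ 2)"
    by (rule shoelace_partial_sum[of y "n-1" x "\<lambda>i. cot (\<beta> i)"])
      (use n3 polygon_edge[OF v] in \<open>auto simp: x_def y_def simp del: times_complex.sel\<close>)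
  also have "\<dots> = (\<Sum>i=1..<n-1. (cot (\<beta> (Suc i)) - cot (\<beta> i)) * y i ^ 2)"
    by (simp only: y_last) simp
  finally have "oriented_area n v = (\<Sum>i=1..<n-1. weight i * y i ^ 2)"
    by (simp add: weight_def flip: sum_divide_distrib)
  then show ?thesis by (simp add: heights_def y_def del: times_complex.sel)
qed

section \<open>Continuity of the coordinates and signs of the form\<close>

lemma continuous_map_heights:
  "continuous_map (polygon_top n s) (product_topology (\<lambda>_. euclideanreal) {1..<n-1}) heights"
  unfolding continuous_map_componentwise
proof (intro conjI ballI)
  show "heights ` topspace (polygon_top n s) \<subseteq> extensional {1..<n-1}"
    by (auto simp: heights_def)
  fix i assume i: "i \<in> {1..<n-1}"
  have proj: "continuous_map (polygon_top n s) euclidean (\<lambda>v. v j)" if "j < n" for j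
    unfolding polygon_top_def
    by (intro continuous_map_from_subtopology continuous_map_product_projection) (use that in simp)
  have "continuous_map (polygon_top n s) euclidean (\<lambda>v. v i - v 0)"
    by (intro continuous_map_diff proj) (use i in auto)
  moreover have "continuous_map euclidean euclideanreal (\<lambda>z. Im (z * cis (-\<theta>)))"
    by (simp del: times_complex.sel) (intro continuous_intros)
  ultimately have "continuous_map (polygon_top n s) euclideanreal ((\<lambda>z. Im (z * cis (-\<theta>))) \<circ> (\<lambda>v. v i - v 0))"
    by (rule continuous_map_compose)
  then show "continuous_map (polygon_top n s) euclideanreal (\<lambda>v. heights v i)"
    using i by (simp add: heights_def o_def del: times_complex.sel)
qed

lemma topspace_polygon_top: "topspace (polygon_top n s) = polygons n s"
  unfolding polygon_top_def using polygons_iff by (auto simp: PiE_def)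

lemma continuous_map_of_heights:
  "continuous_map (product_topology (\<lambda>_. euclideanreal) {1..<n-1}) (polygon_top n s) of_heights"
  (is "continuous_map ?E _ _")
proof -
  have p: "continuous_map ?E euclideanreal (\<lambda>y. pad y i)" for i
  proof (cases "i \<in> {1..<n-1}")
    case True
    have "continuous_map ?E euclideanreal (\<lambda>y. y i)"
      using True by (rule continuous_map_product_projection)
    then show ?thesis using True by (simp add: pad_def)
  next
    case False
    then have "(\<lambda>y. pad y i) = (\<lambda>_. 0)" by (auto simp: pad_def)
    then show ?thesis by simp
  qed
  have o: "continuous_map ?E euclideanreal (\<lambda>y. offset y i)" for i
    unfolding offset_def
    by (intro continuous_map_sum continuous_map_real_mult continuous_map_diff p) auto
  have sc: "continuous_map ?E euclidean (\<lambda>y. h y *\<^sub>R z)"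
    if "continuous_map ?E euclideanreal h" for h and z :: complex
  proof -
    have "continuous_map euclideanreal euclidean (\<lambda>r. r *\<^sub>R z)"
      by simp (intro continuous_intros)
    from continuous_map_compose[OF that this] show ?thesis by (simp add: o_def)
  qed
  \<comment> \<open>Real multiples of two fixed vectors reduce continuity to that of the real
    functions \<open>offset\<close> and \<open>pad\<close>.\<close>
  have eq: "of_heights y i = offset y i *\<^sub>R cis \<theta> + pad y i *\<^sub>R (\<i> * cis \<theta>)" if "i < n" for y i
    using that by (simp add: of_heights_def scaleR_conv_of_real algebra_simps)
  have "continuous_map ?E (product_topology (\<lambda>_. euclidean) {..<n}) of_heights"
    unfolding continuous_map_componentwise
  proof (intro conjI ballI)
    show "of_heights ` topspace ?E \<subseteq> extensional {..<n}" by (auto simp: of_heights_def)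
    fix i assume "i \<in> {..<n}"
    then have i: "i < n" by simp
    show "continuous_map ?E euclidean (\<lambda>y. of_heights y i)"
      unfolding eq[OF i] by (intro continuous_map_add sc o p)
  qed
  then show ?thesis
    unfolding polygon_top_def
    by (rule continuous_map_into_subtopology) (use of_heights_in_polygons in auto)
qed

text \<open>Since \<open>heights\<close> is continuous with section \<open>of_heights\<close>, it
  identifies \<open>Stilde n s\<close> with the space of heights. The predicate \<open>P\<close>
  lets one statement serve both a single area value and the condition on the absolute value.\<close>

lemma Stilde_area_subspace:
  "subtopology (Stilde n s) {C \<in> topspace (Stilde n s). \<forall>v\<in>C. P (oriented_area n v)}
    homeomorphic_space
   subtopology (product_topology (\<lambda>_. euclideanreal) {1..<n-1}) {y. P (\<Sum>i\<in>{1..<n-1}. weight i * y i ^ 2)}"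
  (is "subtopology ?S ?A homeomorphic_space subtopology ?E ?B")
proof -
  have right_inv: "heights (of_heights y) = y" if "y \<in> topspace ?E" for y
    by (rule heights_of_heights) (use that in \<open>auto simp: PiE_def\<close>)
  have equiv: "transl_equiv n v w \<longleftrightarrow> heights v = heights w"
    if "v \<in> topspace (polygon_top n s)" "w \<in> topspace (polygon_top n s)" for v w
    using that unfolding topspace_polygon_top by (rule transl_equiv_iff_heights)
  let ?q = "quotient_top (polygon_top n s) (transl_equiv n)"
  obtain F where "homeomorphic_maps ?q ?E F (\<lambda>y. quot_class (polygon_top n s) (transl_equiv n) (of_heights y))"
    and "\<forall>C \<in> topspace ?q. C \<noteq> {} \<and> C \<subseteq> topspace (polygon_top n s) \<and> (\<forall>v\<in>C. heights v = F C)"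
    by (rule homeomorphic_maps_quotient_top[where R = "transl_equiv n",
          OF continuous_map_heights continuous_map_of_heights right_inv equiv])
  note F = this(1)[folded Stilde_def] and C = this(2)[folded Stilde_def]
  have area: "oriented_area n v = (\<Sum>i\<in>{1..<n-1}. weight i * F C i ^ 2)"
    if "C \<in> topspace ?S" "v \<in> C" for C v
  proof -
    have v: "v \<in> polygons n s" "heights v = F C"
      using bspec[OF C that(1)] that(2) by (auto simp: topspace_polygon_top)
    show ?thesis using oriented_area_heights[OF v(1)] unfolding v(2) .
  qed
  \<comment> \<open>All members of \<open>C\<close> have the same area; nonemptiness of
    \<open>C\<close> keeps the quantifier from being vacuous.\<close>
  have "(\<forall>v\<in>C. P (oriented_area n v)) \<longleftrightarrow> F C \<in> ?B" if C': "C \<in> topspace ?S" for C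
  proof -
    obtain v where "v \<in> C" using bspec[OF C C'] by blast
    then show ?thesis unfolding mem_Collect_eq using area[OF C'] by metis
  qed
  then have A: "?A = {C \<in> topspace ?S. F C \<in> ?B}" by blast
  have "homeomorphic_map ?S ?E F"
    by (rule conjunct1[OF F[unfolded homeomorphic_maps_map]])
  then have surj: "F ` topspace ?S = topspace ?E"
    by (rule homeomorphic_imp_surjective_map)
  have "F ` (topspace ?S \<inter> ?A) = topspace ?E \<inter> ?B"
    unfolding A surj[symmetric] by (rule set_eqI) blast
  from homeomorphic_maps_subtopologies[OF F this] show ?thesis
    by (rule homeomorphic_maps_imp_homeomorphic_space)
qed

text \<open>The cotangent decreases between 0 and \<open>pi\<close>, so a descent of
  \<open>\<beta>\<close> is an ascent of its cotangent. As neighbours differ, no weight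
  vanishes.\<close>

lemma weight_pos_iff:
  assumes "i \<in> {1..<n-1}"
  shows "weight i > 0 \<longleftrightarrow> \<beta> (Suc i) < \<beta> i" and "weight i < 0 \<longleftrightarrow> \<not> \<beta> (Suc i) < \<beta> i"
proof -
  have i: "0 < i" "i < n" "Suc i < n" using assms by auto
  note r = beta_range[OF i(1,2)] beta_range[OF zero_less_Suc i(3)]
  consider "\<beta> (Suc i) < \<beta> i" "cot (\<beta> i) < cot (\<beta> (Suc i))"
    | "\<beta> i < \<beta> (Suc i)" "cot (\<beta> (Suc i)) < cot (\<beta> i)"
    using beta_neq[OF i(1,3)] r cot_strict_antimono by (metis linorder_neqE)
  then show "weight i > 0 \<longleftrightarrow> \<beta> (Suc i) < \<beta> i" "weight i < 0 \<longleftrightarrow> \<not> \<beta> (Suc i) < \<beta> i"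
    unfolding weight_def by (cases; simp)+
qed

end

section \<open>The levels 1 and -1 of the area form and their disjoint union\<close>

theorem mainTheorem3:
  fixes n k :: nat and s :: "nat \<Rightarrow> complex set"
  assumes "n \<ge> 3"
    and "\<forall>i<n. line0 (s i)"
    and "\<forall>i<n. \<forall>j<n. i \<noteq> j \<longrightarrow> s i \<noteq> s j"
    and "total_turn n s = real k * pi"
  shows "S_area n s (-1) homeomorphic_space
           prod_topology (sphere_top (int n - int k - 2)) (disc_top (k - 1))
       \<and> S_area n s 1 homeomorphic_space
           prod_topology (sphere_top (int k - 2)) (disc_top (n - k - 1))
       \<and> S_conf n s homeomorphic_space
           sum_topology (\<lambda>b. if b then prod_topology (sphere_top (int k - 2)) (disc_top (n - k - 1))
                              else prod_topology (sphere_top (int n - int k - 2)) (disc_top (k - 1)))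
             UNIV"
proof -
  obtain \<theta> where \<theta>: "s 0 = line_at \<theta>"
    using line0_imp_line_at assms(1,2) by (metis less_le_trans zero_less_numeral)
  have "\<exists>b. 0 < b \<and> b < pi \<and> s i = line_at (\<theta> + b)" if "0 < i" "i < n" for i
    using line0_relative_angle[of "s i" \<theta>] assms(2,3) that \<theta> by (metis gr_implies_not0 less_trans)
  then obtain \<beta> where \<beta>: "\<And>i. 0 < i \<Longrightarrow> i < n \<Longrightarrow> 0 < \<beta> i \<and> \<beta> i < pi \<and> s i = line_at (\<theta> + \<beta> i)"
    by metis
  have ne: "\<beta> i \<noteq> \<beta> (Suc i)" if "0 < i" "Suc i < n" for i
    using \<beta>[of i] \<beta>[of "Suc i"] assms(3) that by (metis Suc_lessD n_not_Suc_n zero_less_Suc)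
  interpret line_config n s \<theta> \<beta>
    using assms(1) \<theta> \<beta> ne by unfold_locales auto
  let ?I = "{1..<n-1}"
  let ?D = "{i \<in> ?I. \<beta> (Suc i) < \<beta> i}"
  let ?E = "product_topology (\<lambda>_. euclideanreal) ?I"
  let ?Q = "\<lambda>y. \<Sum>i\<in>?I. weight i * y i ^ 2"
  let ?plus = "prod_topology (sphere_top (int k - 2)) (disc_top (n - k - 1))"
  let ?minus = "prod_topology (sphere_top (int n - int k - 2)) (disc_top (k - 1))"
  have "real k * pi = (1 + real (card ?D)) * pi"
    using total_turn_line_at[OF n3 s_0 s_pos beta_range beta_neq] assms(4) by simp
  then have k: "k = 1 + card ?D"
    using pi_neq_zero by (metis mult_right_cancel of_nat_1 of_nat_add of_nat_eq_iff)
  \<comment> \<open>With \<open>k = 1 + card ?D\<close> this bounds \<open>k\<close> by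
    \<open>n - 1\<close>, so the natural-number differences \<open>k - 1\<close> and
    \<open>n - k - 1\<close> are not truncated.\<close>
  have "card ?D \<le> card ?I" by (rule card_mono) auto
  then have kn: "k + 1 \<le> n" using k n3 by simp
  have "card {i \<in> ?I. \<not> \<beta> (Suc i) < \<beta> i} = card (?I - ?D)"
    by (rule arg_cong[of _ _ card]) auto
  also have "\<dots> = card ?I - card ?D" by (rule card_Diff_subset) auto
  finally have notD: "card {i \<in> ?I. \<not> \<beta> (Suc i) < \<beta> i} = n - k - 1" using k by simp
  have pos: "{i \<in> ?I. 0 < weight i} = ?D" and neg: "{i \<in> ?I. weight i < 0} = {i \<in> ?I. \<not> \<beta> (Suc i) < \<beta> i}"
    using weight_pos_iff by blast+
  have nz: "weight i \<noteq> 0" if "i \<in> ?I" for i using weight_pos_iff[OF that] by force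
  have plus: "subtopology ?E {y. ?Q y = 1} homeomorphic_space ?plus"
  proof -
    have e: "int (card ?D) - 1 = int k - 2" using k by simp
    have "subtopology ?E {y. ?Q y = 1} homeomorphic_space
        prod_topology (sphere_top (int (card {i\<in>?I. weight i > 0}) - 1)) (disc_top (card {i\<in>?I. weight i < 0}))"
      by (rule quadric_homeomorphic_sphere_times_disc) (use nz in auto)
    then show ?thesis unfolding pos neg notD e .
  qed
  have minus: "subtopology ?E {y. ?Q y = -1} homeomorphic_space ?minus"
  proof -
    have e: "int (n - k - 1) - 1 = int n - int k - 2" "card ?D = k - 1"
      using k kn by simp_all
    \<comment> \<open>Level -1 of the form is level 1 of its negative, which exchanges the sphere
      and disc indices.\<close>
    have Q: "{y. (\<Sum>i\<in>?I. - weight i * y i ^ 2) = 1} = {y. ?Q y = -1}"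
      by (auto simp: sum_negf)
    have "subtopology ?E {y. (\<Sum>i\<in>?I. - weight i * y i ^ 2) = 1} homeomorphic_space
        prod_topology (sphere_top (int (card {i\<in>?I. - weight i > 0}) - 1)) (disc_top (card {i\<in>?I. - weight i < 0}))"
      by (rule quadric_homeomorphic_sphere_times_disc) (use nz in auto)
    then show ?thesis
      unfolding neg_0_less_iff_less neg_less_0_iff_less pos neg notD Q e .
  qed
  have cQ: "continuous_map ?E euclideanreal ?Q"
    by (intro continuous_map_sum continuous_map_real_mult continuous_map_real_pow
        continuous_map_product_projection) auto
  define Z where "Z = subtopology ?E {y. \<bar>?Q y\<bar> = 1}"
  have cZ: "continuous_map Z euclideanreal ?Q"
    unfolding Z_def by (rule continuous_map_from_subtopology[OF cQ])
  have Zin: "\<bar>?Q y\<bar> = 1" if "y \<in> topspace Z" for y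
    using that by (simp add: Z_def)
  define U where "U b = {y \<in> topspace Z. ?Q y = (if b then 1 else -1)}" for b :: bool
  have sub: "subtopology Z (U b) = subtopology ?E {y. ?Q y = (if b then 1 else -1)}" for b
  proof -
    have "topspace ?E \<inter> ({y. \<bar>?Q y\<bar> = 1} \<inter> U b) = topspace ?E \<inter> {y. ?Q y = (if b then 1 else -1)}"
      unfolding U_def Z_def topspace_subtopology by (cases b) auto
    then have "subtopology ?E (topspace ?E \<inter> ({y. \<bar>?Q y\<bar> = 1} \<inter> U b)) =
        subtopology ?E (topspace ?E \<inter> {y. ?Q y = (if b then 1 else -1)})"
      by (rule arg_cong)
    then show ?thesis
      unfolding Z_def subtopology_subtopology subtopology_restrict .
  qed
  have "Z homeomorphic_space sum_topology (\<lambda>b. if b then ?plus else ?minus) UNIV"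
  proof (rule homeomorphic_space_sum_topology[where U = U])
    fix b :: bool
    \<comment> \<open>On \<open>Z\<close> the form only takes the values 1 and -1, so each level is
      the preimage of an open half-line and hence open in \<open>Z\<close>.\<close>
    have "U b = {y \<in> topspace Z. ?Q y \<in> (if b then {0<..} else {..<0})}"
      using Zin unfolding U_def by (cases b) (force simp: abs_if split: if_splits)+
    moreover have "openin Z {y \<in> topspace Z. ?Q y \<in> (if b then {0<..} else {..<0})}"
      by (rule openin_continuous_map_preimage[OF cZ]) auto
    ultimately show "openin Z (U b)" by simp
    show "subtopology Z (U b) homeomorphic_space (if b then ?plus else ?minus)"
      unfolding sub using plus minus by simp
  next
    show "topspace Z = (\<Union>b\<in>UNIV. U b)"
      using Zin unfolding U_def UNIV_bool by (force simp: abs_if split: if_splits)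
  qed (auto simp: U_def split: if_splits)
  moreover have "S_conf n s homeomorphic_space Z"
    unfolding S_conf_def Z_def by (rule Stilde_area_subspace[where P = "\<lambda>a. \<bar>a\<bar> = 1"])
  moreover have "S_area n s a homeomorphic_space subtopology ?E {y. ?Q y = a}" for a
    unfolding S_area_def by (rule Stilde_area_subspace[where P = "\<lambda>b. b = a"])
  ultimately show ?thesis
    using plus minus by (intro conjI) (rule homeomorphic_space_trans, assumption, assumption)+
qed

end
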